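(* Consider the adjacency-list model augmented with $\texttt{ADJ}$ (and without $\texttt{JUMP}$ and $\texttt{IN-SORTED}$). For any $n$ and $m$ with $n\le m\le n^2$ and any $\delta\in(0,1]$, there exists a directed graph $G=(V,E)$ with $\Theta(n)$ nodes, $\Theta(m)$ edges, and a node $t\in V$, such that for any algorithm solving the single-target problem, the expected running time on $G$ with target $t$ and approximation threshold $\delta$ is $\Omega(m)$.
   Context: Fix a constant $\alpha\in(0,1)$. For a directed graph $G=(V,E)$, an $\alpha$-discounted random walk from $s$: at each step, with probability $\alpha$ it terminates at the current node, otherwise it moves to a uniformly random out-neighbor of the current node. $\pi(s,t)$ is the probability that such a walk from $s$ terminates at $t$. Adjacency-list model: an algorithm accesses $G$ only through constant-time queries $\texttt{DEG-IN}(u)$, $\texttt{DEG-OUT}(u)$ (in-/out-degree of $u$), $\texttt{IN}(u,i)$, $\texttt{OUT}(u,i)$ ($i$-th in-/out-neighbor of $u$); additionally $\texttt{ADJ}(u,v)$ returns whether $(u,v)\in E$. Single-target problem: given $G$ (via queries), a target $t\in V$ and $\delta\in(0,1]$, output estimates $\hat\pi(s,t)$ for all $s\in V$ such that for each $s$, $\Pr\{|\hat\pi(s,t)-\pi(s,t)|\ge\varepsilon\max\{\pi(s,t),\delta\}\}\le p_f$, where $\varepsilon,p_f$ are fixed small constants; an algorithm solves the problem if this holds for every input. *)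

theory Defs
  imports "HOL-Probability.Probability" "HOL-Probability.SPMF" "Graph_Theory.Pair_Digraph"
begin

section \<open>Discounted random walks\<close>

text \<open>
  A directed graph is a finite pair digraph: the arcs are a set of ordered pairs of vertices, and
  loops are allowed. The random walk makes sense only if every node has an out-neighbor, so that is
  required of every graph that occurs below, both the inputs of an algorithm and the hard instance.
  This commits to no convention for nodes without out-neighbors: whatever the convention, an
  algorithm that is correct on all digraphs is in particular correct on these.
\<close>

definition walk_digraph :: "nat pair_pre_digraph \<Rightarrow> bool" where
  "walk_digraph G \<longleftrightarrow> pair_fin_digraph G \<and> (\<forall>u \<in> pverts G. parcs G `` {u} \<noteq> {})"

text \<open>The distribution of the node at which the walk terminates.\<close>

partial_function (spmf) walk :: "real \<Rightarrow> nat pair_pre_digraph \<Rightarrow> nat \<Rightarrow> nat spmf" where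
  "walk \<alpha> G u =
     bind_spmf (spmf_of_pmf (bernoulli_pmf \<alpha>))
       (\<lambda>stop. if stop then return_spmf u
               else bind_spmf (spmf_of_set (parcs G `` {u})) (\<lambda>v. walk \<alpha> G v))"

definition ppr :: "real \<Rightarrow> nat pair_pre_digraph \<Rightarrow> nat \<Rightarrow> nat \<Rightarrow> real" where
  "ppr \<alpha> G s t = spmf (walk \<alpha> G s) t"


section \<open>The adjacency-list model with ADJ\<close>

text \<open>The neighbor lists may be in any order (there is no IN-SORTED access).\<close>

definition adjacency_lists ::
    "nat pair_pre_digraph \<Rightarrow> (nat \<Rightarrow> nat list) \<Rightarrow> (nat \<Rightarrow> nat list) \<Rightarrow> bool" where
  "adjacency_lists G outl inl \<longleftrightarrow>
     (\<forall>u \<in> pverts G. distinct (outl u) \<and> set (outl u) = parcs G `` {u} \<and>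
                     distinct (inl u) \<and> set (inl u) = (parcs G)\<inverse> `` {u})"

datatype query = DegIn nat | DegOut nat | In nat nat | Out nat nat | Adj nat nat

datatype answer = Number nat | Node nat | Truth bool | Invalid

primrec query_nodes :: "query \<Rightarrow> nat set" where
  "query_nodes (DegIn u) = {u}"
| "query_nodes (DegOut u) = {u}"
| "query_nodes (In u i) = {u}"
| "query_nodes (Out u i) = {u}"
| "query_nodes (Adj u v) = {u, v}"

text \<open>Neighbors are numbered from 1.\<close>

definition nth_neighbor :: "nat list \<Rightarrow> nat \<Rightarrow> answer" where
  "nth_neighbor xs i = (if 1 \<le> i \<and> i \<le> length xs then Node (xs ! (i - 1)) else Invalid)"

primrec lookup_query ::
    "nat pair_pre_digraph \<Rightarrow> (nat \<Rightarrow> nat list) \<Rightarrow> (nat \<Rightarrow> nat list) \<Rightarrow> query \<Rightarrow> answer" where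
  "lookup_query G outl inl (DegIn u) = Number (in_degree G u)"
| "lookup_query G outl inl (DegOut u) = Number (out_degree G u)"
| "lookup_query G outl inl (In u i) = nth_neighbor (inl u) i"
| "lookup_query G outl inl (Out u i) = nth_neighbor (outl u) i"
| "lookup_query G outl inl (Adj u v) = Truth ((u, v) \<in> parcs G)"

text \<open>
  A randomized algorithm receives the target and the threshold and, given everything it has done and
  seen so far, chooses its next action at random: a query, a step of local computation (whose result,
  for instance a random number, is encoded as a natural number and remembered), or to stop and
  output an estimate for every node. Queries and local steps cost one unit of time; as a history
  records exactly these, its length is the elapsed time. The output itself is not charged.
\<close>

datatype event = Asked query answer | Computed nat

type_synonym history = "event list"

datatype action = Query query | Compute nat | Output "nat \<Rightarrow> real"

type_synonym algorithm = "nat \<Rightarrow> real \<Rightarrow> history \<Rightarrow> action pmf"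

text \<open>
  Without JUMP the only nodes an algorithm can refer to are the target and the nodes returned by
  earlier queries; a query about any other node reveals nothing. (If node names could be
  guessed, enumerating them would simulate JUMP.)
\<close>

definition known_nodes :: "nat \<Rightarrow> history \<Rightarrow> nat set" where
  "known_nodes t h = insert t {v. \<exists>q. Asked q (Node v) \<in> set h}"

definition reply ::
    "nat pair_pre_digraph \<Rightarrow> (nat \<Rightarrow> nat list) \<Rightarrow> (nat \<Rightarrow> nat list) \<Rightarrow> nat \<Rightarrow> history \<Rightarrow> query \<Rightarrow> answer"
  where
  "reply G outl inl t h q =
     (if query_nodes q \<subseteq> known_nodes t h then lookup_query G outl inl q else Invalid)"

text \<open>
  The joint distribution of the output and the final history, continuing from history \<open>h\<close> (latest
  event first). The missing probability mass is that of not terminating.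
\<close>

partial_function (spmf) run ::
    "algorithm \<Rightarrow> nat pair_pre_digraph \<Rightarrow> (nat \<Rightarrow> nat list) \<Rightarrow> (nat \<Rightarrow> nat list) \<Rightarrow> nat \<Rightarrow> real \<Rightarrow>
     history \<Rightarrow> ((nat \<Rightarrow> real) \<times> history) spmf" where
  "run A G outl inl t \<delta> h =
     bind_spmf (spmf_of_pmf (A t \<delta> h))
       (\<lambda>a. case a of
              Query q \<Rightarrow> run A G outl inl t \<delta> (Asked q (reply G outl inl t h q) # h)
            | Compute k \<Rightarrow> run A G outl inl t \<delta> (Computed k # h)
            | Output est \<Rightarrow> return_spmf (est, h))"

definition expected_time ::
    "algorithm \<Rightarrow> nat pair_pre_digraph \<Rightarrow> (nat \<Rightarrow> nat list) \<Rightarrow> (nat \<Rightarrow> nat list) \<Rightarrow> nat \<Rightarrow> real \<Rightarrow> ennreal"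
  where
  "expected_time A G outl inl t \<delta> =
     (\<integral>\<^sup>+ r. (case r of None \<Rightarrow> \<infinity> | Some (est, h) \<Rightarrow> of_nat (length h))
        \<partial>measure_pmf (run A G outl inl t \<delta> []))"

text \<open>Not producing an output counts as a failure.\<close>

definition solves_single_target :: "real \<Rightarrow> real \<Rightarrow> real \<Rightarrow> algorithm \<Rightarrow> bool" where
  "solves_single_target \<alpha> \<epsilon> p\<^sub>f A \<longleftrightarrow>
     (\<forall>G outl inl t \<delta> s.
        walk_digraph G \<and> adjacency_lists G outl inl \<and> t \<in> pverts G \<and> 0 < \<delta> \<and> \<delta> \<le> 1 \<and> s \<in> pverts G \<longrightarrow>
        measure_pmf.prob (run A G outl inl t \<delta> [])
          {r. case r of
                None \<Rightarrow> True
              | Some (est, h) \<Rightarrow> \<bar>est s - ppr \<alpha> G s t\<bar> \<ge> \<epsilon> * max (ppr \<alpha> G s t) \<delta>}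
        \<le> p\<^sub>f)"

end

theory Submission
  imports Defs
begin

text \<open>
  The hard instance consists of the target \<open>t\<close> with a loop, an isolated node \<open>s\<close> with a loop, a
  bipartite graph with \<open>m\<close> arcs from \<open>U\<close> to \<open>V\<close>, and all arcs from \<open>V\<close> to \<open>t\<close>. There
  \<open>\<pi>(s,t) = 0\<close>. Replacing an arc \<open>(u,v)\<close> and the loop at \<open>s\<close> by \<open>(s,v)\<close> and \<open>(u,s)\<close> keeps all degrees
  but makes \<open>\<pi>(s,t) = (1 - \<alpha>)\<^sup>2\<close>. Until it reveals \<open>(u,v)\<close>, a run cannot tell the two graphs
  apart, because it cannot refer to \<open>s\<close>; as no estimate is accurate for both, it
  reveals \<open>(u,v)\<close> with probability at least \<open>1/2\<close>. An event reveals at most one arc, so summing over the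
  \<open>m\<close> choices of \<open>(u,v)\<close> bounds the expected time by \<open>m/2\<close>.
\<close>

section \<open>Runs on two graphs\<close>

text \<open>Until \<open>bad\<close> occurs both graphs give the same answers, and
  \<open>bad\<close> never goes away, so a run that ends outside \<open>bad\<close> looks the same
  on both. An inequality is claimed because it passes to the limit of the approximations of the run
  on \<open>G\<close>, while the run on \<open>G'\<close> stays the full fixed point.\<close>

lemma run_spmf_le:
  assumes computed: "\<And>h k. I h \<Longrightarrow> I (Computed k # h)"
    and asked: "\<And>h q. I h \<Longrightarrow> bad (Asked q (reply G outl inl t h q) # h) \<or>
        I (Asked q (reply G outl inl t h q) # h) \<and> reply G outl inl t h q = reply G' outl' inl' t h q"
    and bad_Cons: "\<And>x h. bad h \<Longrightarrow> bad (x # h)"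
    and "I h" "\<not> bad h" "\<not> bad h'"
  shows "spmf (run A G outl inl t \<delta> h) (est, h') \<le> spmf (run A G' outl' inl' t \<delta> h) (est, h')"
proof -
  \<comment> \<open>The bound is 0 from a \<open>bad\<close> history, as none of its continuations
    ends outside \<open>bad\<close>. This absorbs the step at which the two answers may
    differ.\<close>
  define b where "b h r = (if bad h then 0 else ennreal (spmf (run A G' outl' inl' t \<delta> h) r))" for h r
  have "\<forall>h r. (bad h \<or> I h) \<longrightarrow> \<not> bad (snd r) \<longrightarrow> ennreal (spmf (run A G outl inl t \<delta> h) r) \<le> b h r"
  proof (induction rule: run.fixp_induct)
    case 1
    show ?case
      unfolding curry_def by (intro admissible_all admissible_imp) (auto intro!: cont_intro)
  next
    case 2
    show ?case by simp
  next
    case (3 f)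
    show ?case
    proof (intro allI impI)
      fix h :: history and r :: "(nat \<Rightarrow> real) \<times> history"
      assume I: "bad h \<or> I h" and r: "\<not> bad (snd r)"
      let ?F = "\<lambda>f a. case a of Query q \<Rightarrow> f (Asked q (reply G outl inl t h q) # h)
          | Compute k \<Rightarrow> f (Computed k # h) | Output est \<Rightarrow> return_spmf (est, h)"
      let ?F' = "\<lambda>a. case a of Query q \<Rightarrow> run A G' outl' inl' t \<delta> (Asked q (reply G' outl' inl' t h q) # h)
          | Compute k \<Rightarrow> run A G' outl' inl' t \<delta> (Computed k # h) | Output est \<Rightarrow> return_spmf (est, h)"
      have step: "ennreal (spmf (?F (f A G outl inl t \<delta>) a) r) \<le> (if bad h then 0 else ennreal (spmf (?F' a) r))"
        for a
      proof (cases a)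
        case (Query q)
        let ?h = "Asked q (reply G outl inl t h q) # h"
        have "bad ?h \<or> I ?h" using I asked bad_Cons by blast
        then have "ennreal (spmf (f A G outl inl t \<delta> ?h) r) \<le> b ?h r" using 3 r by blast
        also have "\<dots> \<le> (if bad h then 0 else ennreal (spmf (?F' a) r))"
          using I asked[of h q] bad_Cons[of h] Query by (auto simp: b_def)
        finally show ?thesis using Query by simp
      next
        case (Compute k)
        let ?h = "Computed k # h"
        have "bad ?h \<or> I ?h" using I computed bad_Cons by blast
        then have "ennreal (spmf (f A G outl inl t \<delta> ?h) r) \<le> b ?h r" using 3 r by blast
        also have "\<dots> \<le> (if bad h then 0 else ennreal (spmf (?F' a) r))"
          using bad_Cons[of h] Compute by (auto simp: b_def)
        finally show ?thesis using Compute by simp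
      next
        case (Output est)
        then show ?thesis using r by (auto split: split_indicator)
      qed
      have "ennreal (spmf (spmf_of_pmf (A t \<delta> h) \<bind> ?F (f A G outl inl t \<delta>)) r)
          = (\<integral>\<^sup>+ a. ennreal (spmf (?F (f A G outl inl t \<delta>) a) r) \<partial>measure_pmf (A t \<delta> h))"
        unfolding bind_spmf_of_pmf by (rule ennreal_pmf_bind)
      also have "\<dots> \<le> (\<integral>\<^sup>+ a. (if bad h then 0 else ennreal (spmf (?F' a) r)) \<partial>measure_pmf (A t \<delta> h))"
        by (intro nn_integral_mono step)
      also have "\<dots> = (if bad h then 0 else ennreal (spmf (spmf_of_pmf (A t \<delta> h) \<bind> ?F') r))"
        unfolding bind_spmf_of_pmf ennreal_pmf_bind by simp
      also have "\<dots> = b h r"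
        unfolding b_def by (subst run.simps) simp
      finally show "ennreal (spmf (spmf_of_pmf (A t \<delta> h) \<bind> ?F (f A G outl inl t \<delta>)) r) \<le> b h r" .
    qed
  qed
  then have "ennreal (spmf (run A G outl inl t \<delta> h) (est, h')) \<le> b h (est, h')"
    using assms(4,6) by simp
  then show ?thesis using assms(5) by (simp add: b_def)
qed

text \<open>First-step analysis. For a loop, \<open>w = u\<close>, it is a linear equation that
  determines the value if \<alpha> > 0, so no series has to be summed.\<close>

lemma ppr_single_out_neighbor:
  assumes "0 \<le> \<alpha>" "\<alpha> \<le> 1" "parcs G `` {u} = {w}"
  shows "ppr \<alpha> G u t = (if u = t then \<alpha> else 0) + (1 - \<alpha>) * ppr \<alpha> G w t"
  unfolding ppr_def using assms
  by (subst walk.simps) (simp add: bind_spmf_of_pmf pmf_bind spmf_of_set_singleton)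

section \<open>Rewiring an arc through an isolated node\<close>

text \<open>Meant to contain the arcs whose rewiring could change the answer. Degree queries
  contribute none, as rewiring keeps degrees; \<open>Adj\<close> contributes its pair even if the
  answer is negative, which still leaves one pair per event.\<close>

fun event_arcs :: "event \<Rightarrow> (nat \<times> nat) set" where
  "event_arcs (Asked (In v i) (Node u)) = {(u, v)}"
| "event_arcs (Asked (Out u i) (Node v)) = {(u, v)}"
| "event_arcs (Asked (Adj u v) a) = {(u, v)}"
| "event_arcs _ = {}"

definition revealed_arcs :: "history \<Rightarrow> (nat \<times> nat) set" where
  "revealed_arcs h = (\<Union>x\<in>set h. event_arcs x)"

lemma finite_event_arcs: "finite (event_arcs x)"
  and card_event_arcs_le: "card (event_arcs x) \<le> 1"
  by (cases x rule: event_arcs.cases; simp)+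

lemma card_Int_revealed_arcs_le: "card (E \<inter> revealed_arcs h) \<le> length h"
proof -
  have "card (E \<inter> revealed_arcs h) \<le> card (revealed_arcs h)"
    by (rule card_mono) (auto simp: revealed_arcs_def finite_event_arcs)
  also have "\<dots> \<le> length h"
  proof (induction h)
    case (Cons x h)
    have "revealed_arcs (x # h) = event_arcs x \<union> revealed_arcs h" by (simp add: revealed_arcs_def)
    then show ?case
      using Cons card_Un_le[of "event_arcs x" "revealed_arcs h"] card_event_arcs_le[of x] by simp
  qed (simp add: revealed_arcs_def)
  finally show ?thesis .
qed

text \<open>Turns degree answers into list lengths, which do not change when single entries are
  replaced.\<close>

lemma adjacency_lists_degree:
  assumes "adjacency_lists G outl inl" "x \<in> pverts G"
  shows "in_degree G x = length (inl x)" "out_degree G x = length (outl x)"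
proof -
  have x: "distinct (inl x)" "distinct (outl x)" using assms by (auto simp: adjacency_lists_def)
  have "in_arcs G x = (\<lambda>y. (y, x)) ` set (inl x)"
    using assms by (auto simp: adjacency_lists_def in_arcs_def with_proj_def)
  then show "in_degree G x = length (inl x)"
    using x by (simp add: in_degree_def card_image inj_on_def distinct_card)
  have "out_arcs G x = (\<lambda>y. (x, y)) ` set (outl x)"
    using assms by (auto simp: adjacency_lists_def out_arcs_def with_proj_def)
  then show "out_degree G x = length (outl x)"
    using x by (simp add: out_degree_def card_image inj_on_def distinct_card)
qed

text \<open>Collects what the rewiring argument uses of the hard instance. By
  \<open>isolated\<close> the loop is the only arc at \<open>s\<close>, so neither walks nor queries
  that start at \<open>t\<close> reach \<open>s\<close>.\<close>

locale rewirable_arc =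
  fixes G :: "nat pair_pre_digraph" and outl inl :: "nat \<Rightarrow> nat list" and s u v t :: nat
  assumes walk_digraph: "walk_digraph G"
    and lists: "adjacency_lists G outl inl"
    and isolated: "\<And>a b. (a, b) \<in> parcs G \<Longrightarrow> a = s \<longleftrightarrow> b = s"
    and loop: "(s, s) \<in> parcs G"
    and arc: "(u, v) \<in> parcs G"
    and v: "v \<noteq> s" "v \<noteq> t" "parcs G `` {v} = {t}"
    and t: "t \<noteq> s" "parcs G `` {t} = {t}"
begin

section \<open>The rewired graph and its neighbor lists\<close>

definition G' :: "nat pair_pre_digraph" where
  "G' = \<lparr>pverts = pverts G, parcs = parcs G - {(u, v), (s, s)} \<union> {(s, v), (u, s)}\<rparr>"

text \<open>Entries are replaced in place, here and in \<open>inl'\<close>, so that in the lists of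
  nodes other than \<open>s\<close> only the position of the removed arc changes.\<close>

definition outl' :: "nat \<Rightarrow> nat list" where
  "outl' = outl(s := [v], u := map (\<lambda>y. if y = v then s else y) (outl u))"

definition inl' :: "nat \<Rightarrow> nat list" where
  "inl' = inl(s := [u], v := map (\<lambda>y. if y = u then s else y) (inl v))"

lemma wf: "(a, b) \<in> parcs G \<Longrightarrow> a \<in> pverts G \<and> b \<in> pverts G"
  using walk_digraph unfolding walk_digraph_def pair_fin_digraph_def pair_wf_digraph_def by fastforce

lemma u: "u \<noteq> s" "u \<noteq> v" "u \<noteq> t"
  using isolated arc v t by auto

lemma walk_digraph': "walk_digraph G'"
proof -
  have "finite (pverts G)" "finite (parcs G)" "\<forall>x\<in>pverts G. \<exists>y. (x, y) \<in> parcs G"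
    using walk_digraph by (auto simp: walk_digraph_def pair_fin_digraph_def pair_fin_digraph_axioms_def)
  then show ?thesis
    using wf arc loop unfolding walk_digraph_def pair_fin_digraph_def pair_fin_digraph_axioms_def
      pair_wf_digraph_def G'_def by (auto simp: Image_def) blast+
qed

lemma lists': "adjacency_lists G' outl' inl'"
  unfolding adjacency_lists_def
proof (intro ballI conjI)
  fix x assume "x \<in> pverts G'"
  then have x: "distinct (outl x)" "set (outl x) = parcs G `` {x}"
      "distinct (inl x)" "set (inl x) = (parcs G)\<inverse> `` {x}"
    using lists by (auto simp: adjacency_lists_def G'_def)
  \<comment> \<open>Renaming an entry to \<open>s\<close> keeps a list distinct because
    \<open>s\<close> did not occur in it.\<close>
  have notin: "x \<noteq> s \<Longrightarrow> s \<notin> set (outl x)" "x \<noteq> s \<Longrightarrow> s \<notin> set (inl x)"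
    using isolated x by auto
  show "distinct (outl' x)" using x notin u by (auto simp: outl'_def distinct_map inj_on_def)
  show "distinct (inl' x)" using x notin v by (auto simp: inl'_def distinct_map inj_on_def)
  show "set (outl' x) = parcs G' `` {x}"
    using x isolated u v arc by (auto simp: outl'_def G'_def image_iff)
  show "set (inl' x) = (parcs G')\<inverse> `` {x}"
    using x isolated u v arc by (auto simp: inl'_def G'_def image_iff)
qed

section \<open>Indistinguishability until the arc is revealed\<close>

lemma lookup_query_eq:
  assumes "query_nodes q \<subseteq> pverts G - {s}"
  shows "(u, v) \<in> event_arcs (Asked q (lookup_query G outl inl q)) \<or>
    lookup_query G outl inl q = lookup_query G' outl' inl' q"
proof -
  have verts: "pverts G' = pverts G" by (simp add: G'_def)
  \<comment> \<open>Equal lengths settle the degree queries. As the query avoids \<open>s\<close>,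
    answers can differ only at the two list positions holding the arc and for
    \<open>Adj u v\<close>, and each of these reveals it.\<close>
  have "length (outl' x) = length (outl x)" "length (inl' x) = length (inl x)" if "x \<noteq> s" for x
    using that by (simp_all add: outl'_def inl'_def)
  then show ?thesis
    using assms
    by (cases q)
      (auto simp: adjacency_lists_degree[OF lists] adjacency_lists_degree[OF lists'] verts nth_neighbor_def,
        auto simp: outl'_def inl'_def G'_def split: if_splits)
qed

text \<open>The nodes other than \<open>s\<close> are closed under neighbors in both directions, so
  a run on \<open>G\<close> never learns the name \<open>s\<close>.\<close>

lemma lookup_query_Node:
  assumes "query_nodes q \<subseteq> pverts G - {s}" "lookup_query G outl inl q = Node x"
  shows "x \<in> pverts G - {s}"
proof -
  have "x \<in> set (outl y) \<or> x \<in> set (inl y)" if "y \<in> query_nodes q" for y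
    using assms that by (cases q) (auto simp: nth_neighbor_def split: if_splits)
  then obtain y where "y \<in> pverts G - {s}" "x \<in> set (outl y) \<or> x \<in> set (inl y)"
    using assms(1) by (cases q) auto
  then have "y \<noteq> s" "(y, x) \<in> parcs G \<or> (x, y) \<in> parcs G"
    using lists by (auto simp: adjacency_lists_def)
  then show ?thesis using wf isolated by blast
qed

lemma run_le:
  assumes "(u, v) \<notin> revealed_arcs h"
  shows "spmf (run A G outl inl t \<delta> []) (est, h) \<le> spmf (run A G' outl' inl' t \<delta> []) (est, h)"
proof (rule run_spmf_le[where I = "\<lambda>h. known_nodes t h \<subseteq> pverts G - {s}"
      and bad = "\<lambda>h. (u, v) \<in> revealed_arcs h"])
  fix h k assume "known_nodes t h \<subseteq> pverts G - {s}"
  then show "known_nodes t (Computed k # h) \<subseteq> pverts G - {s}" by (auto simp: known_nodes_def)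
next
  fix h q assume known: "known_nodes t h \<subseteq> pverts G - {s}"
  let ?a = "reply G outl inl t h q"
  have "x \<in> pverts G - {s}" if "?a = Node x" for x
    using that known lookup_query_Node[of q x] by (auto simp: reply_def split: if_splits)
  then have "known_nodes t (Asked q ?a # h) \<subseteq> pverts G - {s}"
    using known by (auto simp: known_nodes_def dest: sym)
  \<comment> \<open>A query about an unknown node gets \<open>Invalid\<close> on both graphs,
    because \<open>known_nodes\<close> depends only on the target and the history.\<close>
  moreover have "(u, v) \<in> event_arcs (Asked q ?a) \<or> ?a = reply G' outl' inl' t h q"
    using known lookup_query_eq[of q] by (auto simp: reply_def)
  ultimately show "(u, v) \<in> revealed_arcs (Asked q ?a # h) \<or>
      known_nodes t (Asked q ?a # h) \<subseteq> pverts G - {s} \<and> ?a = reply G' outl' inl' t h q"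
    by (auto simp: revealed_arcs_def)
next
  show "known_nodes t [] \<subseteq> pverts G - {s}" using t wf by (auto simp: known_nodes_def)
qed (use assms in \<open>auto simp: revealed_arcs_def\<close>)

section \<open>The walk from the isolated node in both graphs\<close>

lemma ppr_eq_0:
  assumes "0 < \<alpha>" "\<alpha> < 1"
  shows "ppr \<alpha> G s t = 0"
proof -
  have "parcs G `` {s} = {s}" using loop isolated by auto
  \<comment> \<open>The loop gives x = (1 - \<alpha>) x, hence x = 0 by \<alpha> > 0.\<close>
  then show ?thesis using ppr_single_out_neighbor[of \<alpha> G s s t] assms t by (simp add: algebra_simps)
qed

text \<open>The walk is forced through \<open>v\<close> to \<open>t\<close> and stays there, so it
  ends at \<open>t\<close> unless it stops at \<open>s\<close> or at \<open>v\<close>.\<close>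

lemma ppr'_eq:
  assumes "0 < \<alpha>" "\<alpha> < 1"
  shows "ppr \<alpha> G' s t = (1 - \<alpha>)\<^sup>2"
proof -
  have out: "parcs G' `` {s} = {v}" "parcs G' `` {v} = {t}" "parcs G' `` {t} = {t}"
    using u v t isolated by (auto simp: G'_def)
  have "ppr \<alpha> G' t t = 1"
    using ppr_single_out_neighbor[OF _ _ out(3), of \<alpha> t] assms by (simp add: algebra_simps)
  then show ?thesis
    using ppr_single_out_neighbor[OF _ _ out(1), of \<alpha> t] ppr_single_out_neighbor[OF _ _ out(2), of \<alpha> t]
      assms t v by (simp add: power2_eq_square)
qed

text \<open>A terminating run that keeps the arc hidden is wrong about \<open>s\<close> on
  \<open>G\<close> or would be wrong on \<open>G'\<close>; \<open>run_le\<close> transfers the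
  second case to \<open>G'\<close>, so each case costs one \<open>p\<close>. Nontermination is
  grouped with revealing, since \<open>run_le\<close> speaks of terminating runs and the time is
  infinite otherwise.\<close>

lemma prob_revealed_ge:
  assumes \<alpha>: "0 < \<alpha>" "\<alpha> < 1" and \<epsilon>: "0 < \<epsilon>" "\<epsilon> \<le> (1 - \<alpha>)\<^sup>2 / 2" and \<delta>: "0 < \<delta>" "\<delta> \<le> 1"
    and A: "solves_single_target \<alpha> \<epsilon> p A"
  shows "1 - 2 * p \<le> measure_pmf.prob (run A G outl inl t \<delta> [])
    {r. case r of None \<Rightarrow> True | Some (est, h) \<Rightarrow> (u, v) \<in> revealed_arcs h}" (is "_ \<le> measure_pmf.prob ?M ?R")
proof -
  let ?M' = "run A G' outl' inl' t \<delta> []"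
  let ?B = "{r. case r of None \<Rightarrow> True
    | Some (est, h) \<Rightarrow> \<bar>est s - ppr \<alpha> G s t\<bar> \<ge> \<epsilon> * max (ppr \<alpha> G s t) \<delta>}"
  let ?B' = "{r. case r of None \<Rightarrow> True
    | Some (est, h) \<Rightarrow> \<bar>est s - ppr \<alpha> G' s t\<bar> \<ge> \<epsilon> * max (ppr \<alpha> G' s t) \<delta>}"
  have verts: "s \<in> pverts G" "t \<in> pverts G" "s \<in> pverts G'" "t \<in> pverts G'"
    using wf loop t by (auto simp: G'_def)
  have B: "measure_pmf.prob ?M ?B \<le> p"
    using A walk_digraph lists verts \<delta> unfolding solves_single_target_def by blast
  have B': "measure_pmf.prob ?M' ?B' \<le> p"
    using A walk_digraph' lists' verts \<delta> unfolding solves_single_target_def by blast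
  have sub: "- ?R - ?B \<subseteq> ?B'"
  proof
    fix r assume r: "r \<in> - ?R - ?B"
    then obtain est h where [simp]: "r = Some (est, h)" by (cases r) auto
    have "\<bar>est s\<bar> < \<epsilon> * \<delta>" using r \<alpha> \<delta> by (simp add: ppr_eq_0)
    also have "\<dots> \<le> \<epsilon>" using \<epsilon> \<delta> by (simp add: mult_left_le)
    \<comment> \<open>As (1 - \<alpha>)^2 is at least 2 \<epsilon>, an estimate within \<epsilon> of
      0 is at least \<epsilon> away from it.\<close>
    finally have "\<bar>est s - (1 - \<alpha>)\<^sup>2\<bar> \<ge> \<epsilon>" using \<epsilon> by linarith
    moreover have "\<epsilon> * max ((1 - \<alpha>)\<^sup>2) \<delta> \<le> \<epsilon>"
      using \<epsilon> \<delta> \<alpha> by (intro mult_left_le) (auto simp: power_le_one)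
    ultimately show "r \<in> ?B'" using \<alpha> by (simp add: ppr'_eq)
  qed
  \<comment> \<open>The bound of \<open>run_le\<close> on single outcomes is integrated to one on
    the whole set.\<close>
  have "emeasure (measure_pmf ?M) (- ?R - ?B) = (\<integral>\<^sup>+ r. pmf ?M r \<partial>count_space (- ?R - ?B))"
    by (simp add: nn_integral_pmf)
  also have "\<dots> \<le> (\<integral>\<^sup>+ r. pmf ?M' r \<partial>count_space (- ?R - ?B))"
    by (intro nn_integral_mono) (auto intro: run_le split: option.splits)
  also have "\<dots> = emeasure (measure_pmf ?M') (- ?R - ?B)"
    by (simp add: nn_integral_pmf)
  also have "\<dots> \<le> emeasure (measure_pmf ?M') ?B'"
    using sub by (intro emeasure_mono) auto
  finally have "measure_pmf.prob ?M (- ?R - ?B) \<le> p"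
    using B' by (simp add: measure_pmf.emeasure_eq_measure)
  moreover have "measure_pmf.prob ?M (- ?R) \<le> measure_pmf.prob ?M ((- ?R - ?B) \<union> ?B)"
    by (intro measure_pmf.finite_measure_mono) auto
  moreover have "\<dots> \<le> measure_pmf.prob ?M (- ?R - ?B) + measure_pmf.prob ?M ?B"
    by (intro measure_Un_le) auto
  moreover have "measure_pmf.prob ?M (- ?R) = 1 - measure_pmf.prob ?M ?R"
    by (subst measure_pmf.prob_compl[symmetric]) (auto simp: Compl_eq_Diff_UNIV)
  ultimately show ?thesis using B by linarith
qed

end

section \<open>From revealing probabilities to expected time\<close>

lemma expected_time_ge_sum_prob_revealed:
  assumes "finite E"
  shows "(\<Sum>e\<in>E. ennreal (measure_pmf.prob (run A G outl inl t \<delta> [])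
    {r. case r of None \<Rightarrow> True | Some (est, h) \<Rightarrow> e \<in> revealed_arcs h})) \<le> expected_time A G outl inl t \<delta>"
proof -
  let ?M = "run A G outl inl t \<delta> []"
  let ?R = "\<lambda>e. {r :: ((nat \<Rightarrow> real) \<times> history) option.
    case r of None \<Rightarrow> True | Some (est, h) \<Rightarrow> e \<in> revealed_arcs h}"
  have "(\<Sum>e\<in>E. ennreal (measure_pmf.prob ?M (?R e))) = (\<Sum>e\<in>E. \<integral>\<^sup>+ r. indicator (?R e) r \<partial>measure_pmf ?M)"
    by (simp add: measure_pmf.emeasure_eq_measure)
  also have "\<dots> = (\<integral>\<^sup>+ r. (\<Sum>e\<in>E. indicator (?R e) r) \<partial>measure_pmf ?M)"
    by (rule nn_integral_sum[symmetric]) simp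
  \<comment> \<open>For a terminating run the inner sum counts the arcs of \<open>E\<close> that it
    reveals, at most one per event; otherwise the time is infinite.\<close>
  also have "\<dots> \<le> expected_time A G outl inl t \<delta>"
    unfolding expected_time_def
  proof (intro nn_integral_mono)
    fix r :: "((nat \<Rightarrow> real) \<times> history) option"
    show "(\<Sum>e\<in>E. indicator (?R e) r) \<le> (case r of None \<Rightarrow> \<infinity> | Some (est, h) \<Rightarrow> (of_nat (length h) :: ennreal))"
    proof (cases r)
      case (Some x)
      have "(\<Sum>e\<in>E. indicator (?R e) r :: ennreal) = of_nat (card (E \<inter> revealed_arcs (snd x)))"
        using assms Some by (cases x) (simp add: indicator_def sum.If_cases Int_def)
      also have "\<dots> \<le> of_nat (length (snd x))"
        by (simp add: card_Int_revealed_arcs_le)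
      finally show ?thesis using Some by (cases x) simp
    qed simp
  qed
  finally show ?thesis .
qed

section \<open>The hard instance\<close>

text \<open>The target is 0, the isolated node is 1, and \<open>U = {2..<2 + n}\<close>, \<open>V = {2 + n..<2 + 2 * n}\<close>.\<close>

definition hard_digraph :: "nat \<Rightarrow> (nat \<times> nat) set \<Rightarrow> nat pair_pre_digraph" where
  "hard_digraph n E = \<lparr>pverts = {..<2 + 2 * n},
     parcs = E \<union> (\<lambda>v. (v, 0)) ` {2 + n..<2 + 2 * n} \<union> {(0, 0), (1, 1)}\<rparr>"

text \<open>\<open>total\<close> secures the out-neighbors of the nodes in U that
  \<open>walk_digraph\<close> demands; every other node has an arc to 0 or a loop.\<close>

locale hard_instance =
  fixes n :: nat and E :: "(nat \<times> nat) set"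
  assumes bipartite: "E \<subseteq> {2..<2 + n} \<times> {2 + n..<2 + 2 * n}"
    and total: "\<And>u. u \<in> {2..<2 + n} \<Longrightarrow> \<exists>v. (u, v) \<in> E"
begin

lemma finite_arcs: "finite E"
  using bipartite by (rule finite_subset) simp

lemma walk_digraph_hard: "walk_digraph (hard_digraph n E)"
proof -
  have "\<exists>y. (x, y) \<in> parcs (hard_digraph n E)" if x: "x < 2 + 2 * n" for x
  proof -
    consider "x = 0" | "x = 1" | "x \<in> {2..<2 + n}" | "x \<in> {2 + n..<2 + 2 * n}"
      using x unfolding atLeastLessThan_iff by linarith
    then show ?thesis
    proof cases
      case 3
      then show ?thesis using total by (auto simp: hard_digraph_def)
    next
      case 4
      then have "(x, 0) \<in> parcs (hard_digraph n E)" by (simp add: hard_digraph_def)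
      then show ?thesis ..
    qed (auto simp: hard_digraph_def)
  qed
  then show ?thesis
    using bipartite finite_arcs
    unfolding walk_digraph_def pair_fin_digraph_def pair_fin_digraph_axioms_def pair_wf_digraph_def Image_singleton
    by (auto simp: hard_digraph_def)
qed

lemma card_parcs_hard: "card (parcs (hard_digraph n E)) = card E + n + 2"
proof -
  have "card (E \<union> (\<lambda>v. (v, 0)) ` {2 + n..<2 + 2 * n}) = card E + card ((\<lambda>v. (v, 0::nat)) ` {2 + n..<2 + 2 * n})"
    using finite_arcs bipartite by (intro card_Un_disjoint) auto
  also have "\<dots> = card E + n" by (simp add: card_image inj_on_def)
  finally show ?thesis
    using finite_arcs bipartite unfolding hard_digraph_def
    by (subst pair_pre_digraph.simps, subst card_Un_disjoint) auto
qed

text \<open>Every arc of \<open>E\<close> qualifies, whatever the order of the lists: its head lies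
  in V, where 0 is the only out-neighbor of each node.\<close>

lemma rewirable_arc_hard:
  assumes "adjacency_lists (hard_digraph n E) outl inl" "(u, v) \<in> E"
  shows "rewirable_arc (hard_digraph n E) outl inl 1 u v 0"
proof
  show "walk_digraph (hard_digraph n E)" by (rule walk_digraph_hard)
  show "a = 1 \<longleftrightarrow> b = 1" if "(a, b) \<in> parcs (hard_digraph n E)" for a b
    using that bipartite by (auto simp: hard_digraph_def)
  have "v \<in> {2 + n..<2 + 2 * n}" using assms(2) bipartite by blast
  moreover then have "(v, x) \<notin> E" for x using bipartite by auto
  ultimately show "v \<noteq> 1" "v \<noteq> 0" "parcs (hard_digraph n E) `` {v} = {0}"
    by (auto simp: hard_digraph_def)
  show "parcs (hard_digraph n E) `` {0} = {0}"
    using bipartite by (auto simp: hard_digraph_def)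
qed (use assms in \<open>auto simp: hard_digraph_def\<close>)

lemma expected_time_hard_ge:
  assumes "adjacency_lists (hard_digraph n E) outl inl"
    and "0 < \<alpha>" "\<alpha> < 1" "0 < \<epsilon>" "\<epsilon> \<le> (1 - \<alpha>)\<^sup>2 / 2" "0 < \<delta>" "\<delta> \<le> 1"
    and "solves_single_target \<alpha> \<epsilon> p A" "p \<le> 1 / 4"
  shows "ennreal (1 / 2 * card E) \<le> expected_time A (hard_digraph n E) outl inl 0 \<delta>"
proof -
  let ?P = "\<lambda>e. measure_pmf.prob (run A (hard_digraph n E) outl inl 0 \<delta> [])
    {r. case r of None \<Rightarrow> True | Some (est, h) \<Rightarrow> e \<in> revealed_arcs h}"
  \<comment> \<open>The bound 1 - 2 p is at least 1/2 because p \<le> 1/4.\<close>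
  have "1 / 2 \<le> ?P e" if "e \<in> E" for e
    using rewirable_arc.prob_revealed_ge[OF rewirable_arc_hard[OF assms(1)] assms(2-8), of "fst e" "snd e"]
      that assms(9) by simp
  then have "1 / 2 * card E \<le> (\<Sum>e\<in>E. ?P e)"
    using sum_mono[of E "\<lambda>_. 1 / 2" ?P] by simp
  then have "ennreal (1 / 2 * card E) \<le> (\<Sum>e\<in>E. ennreal (?P e))"
    by (subst sum_ennreal) (auto intro: ennreal_leI)
  also have "\<dots> \<le> expected_time A (hard_digraph n E) outl inl 0 \<delta>"
    by (rule expected_time_ge_sum_prob_revealed[OF finite_arcs])
  finally show ?thesis .
qed

end

lemma hard_instance_exists:
  assumes "n \<le> m" "m \<le> n ^ 2"
  obtains E where "hard_instance n E" "card E = m"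
proof -
  \<comment> \<open>A perfect matching gives every node of U an out-neighbor. As n \<le> m \<le>
    n^2, it can be enlarged to exactly m arcs inside the complete bipartite graph.\<close>
  let ?D = "(\<lambda>u. (u, u + n)) ` {2..<2 + n}"
  have "card ?D = n" by (simp add: card_image inj_on_def)
  then have "\<exists>E. ?D \<subseteq> E \<and> E \<subseteq> {2..<2 + n} \<times> {2 + n..<2 + 2 * n} \<and> card E = m"
    using assms by (intro exists_subset_between) (auto simp: power2_eq_square)
  then obtain E where E: "?D \<subseteq> E" "E \<subseteq> {2..<2 + n} \<times> {2 + n..<2 + 2 * n}" "card E = m" by blast
  then have "hard_instance n E" by unfold_locales blast+
  then show thesis using E that by blast
qed

theorem theorem5p4:
  fixes \<alpha> :: real
  assumes "0 < \<alpha>" and "\<alpha> < 1"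
  shows "\<exists>\<epsilon>\<^sub>0 > 0. \<exists>p\<^sub>0 > 0. \<forall>\<epsilon> p\<^sub>f. 0 < \<epsilon> \<and> \<epsilon> \<le> \<epsilon>\<^sub>0 \<and> 0 < p\<^sub>f \<and> p\<^sub>f \<le> p\<^sub>0 \<longrightarrow>
    (\<exists>c\<^sub>1 > 0. \<exists>c\<^sub>2 > 0. \<exists>c > 0.
      \<forall>(n::nat) (m::nat) (\<delta>::real). 1 \<le> n \<and> n \<le> m \<and> m \<le> n ^ 2 \<and> 0 < \<delta> \<and> \<delta> \<le> 1 \<longrightarrow>
        (\<exists>G t. walk_digraph G \<and> t \<in> pverts G \<and>
           c\<^sub>1 * real n \<le> real (card (pverts G)) \<and> real (card (pverts G)) \<le> c\<^sub>2 * real n \<and>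
           c\<^sub>1 * real m \<le> real (card (parcs G)) \<and> real (card (parcs G)) \<le> c\<^sub>2 * real m \<and>
           (\<forall>outl inl A. adjacency_lists G outl inl \<and> solves_single_target \<alpha> \<epsilon> p\<^sub>f A \<longrightarrow>
              ennreal (c * real m) \<le> expected_time A G outl inl t \<delta>)))"
proof (rule exI[of _ "(1 - \<alpha>)\<^sup>2 / 2"], rule conjI, use assms in simp,
    rule exI[of _ "1 / 4"], rule conjI, simp, intro allI impI,
    rule exI[of _ 1], rule conjI, simp, rule exI[of _ 4], rule conjI, simp,
    rule exI[of _ "1 / 2"], rule conjI, simp, intro allI impI)
  \<comment> \<open>The choice of \<open>\<epsilon>\<^sub>0\<close> keeps the accurate estimates for
    the two graphs apart, and \<open>p\<^sub>0 = 1 / 4\<close> yields \<open>c = 1 / 2\<close>. The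
    factor 4 covers 2 + 2 n nodes and m + n + 2 arcs, as 1 \<le> n \<le> m.\<close>
  fix \<epsilon> p\<^sub>f \<delta> :: real and n m :: nat
  assume \<epsilon>p: "0 < \<epsilon> \<and> \<epsilon> \<le> (1 - \<alpha>)\<^sup>2 / 2 \<and> 0 < p\<^sub>f \<and> p\<^sub>f \<le> 1 / 4"
    and nm: "1 \<le> n \<and> n \<le> m \<and> m \<le> n ^ 2 \<and> 0 < \<delta> \<and> \<delta> \<le> 1"
  obtain E where E: "hard_instance n E" "card E = m" using hard_instance_exists nm by blast
  interpret hard_instance n E by fact
  show "\<exists>G t. walk_digraph G \<and> t \<in> pverts G \<and>
           1 * real n \<le> real (card (pverts G)) \<and> real (card (pverts G)) \<le> 4 * real n \<and>
           1 * real m \<le> real (card (parcs G)) \<and> real (card (parcs G)) \<le> 4 * real m \<and>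
           (\<forall>outl inl A. adjacency_lists G outl inl \<and> solves_single_target \<alpha> \<epsilon> p\<^sub>f A \<longrightarrow>
              ennreal (1 / 2 * real m) \<le> expected_time A G outl inl t \<delta>)"
  proof (intro exI conjI allI impI)
    show "walk_digraph (hard_digraph n E)" by (rule walk_digraph_hard)
    show "ennreal (1 / 2 * real m) \<le> expected_time A (hard_digraph n E) outl inl 0 \<delta>"
      if "adjacency_lists (hard_digraph n E) outl inl \<and> solves_single_target \<alpha> \<epsilon> p\<^sub>f A" for outl inl A
      using expected_time_hard_ge[of outl inl \<alpha> \<epsilon> \<delta> p\<^sub>f A] that assms \<epsilon>p nm E(2) by simp
  qed (use nm E(2) in \<open>auto simp: card_parcs_hard, auto simp: hard_digraph_def\<close>)
qed

end
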